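(* Let $h>0$ be such that $$h\max\{\sup_{x\in\omega}|\kappa_1|,\sup_{x\in\omega}|\kappa_2|\}<\alpha\quad\text{with}\quad\alpha<\sqrt{\tfrac23(29-\sqrt{761})}\simeq0.97083,$$ and let the constitutive coefficients satisfy $\mu>0$, $\mu_{\rm c}>0$, $2\lambda+\mu>0$, $b_1>0$, $b_2>0$, $b_3>0$. Then the energy density $$W(\mathcal{E}_{m,s},\mathcal{K}_{e,s})=W_{\rm memb}(\mathcal{E}_{m,s})+W_{\rm memb,bend}(\mathcal{E}_{m,s},\mathcal{K}_{e,s})+W_{\rm bend,curv}(\mathcal{K}_{e,s})$$ defined in the context is coercive, in the sense that there exists a constant $a_1^+>0$, depending on the constitutive coefficients, such that $W(\mathcal{E}_{m,s},\mathcal{K}_{e,s})\ge a_1^+\big(\|\mathcal{E}_{m,s}\|^2+\|\mathcal{K}_{e,s}\|^2\big)$.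
   Context: Tensor notation: $\langle X,Y\rangle=\mathrm{tr}(XY^T)$, $\|X\|$ is the Frobenius norm, $\mathrm{sym}X=\frac12(X+X^T)$, $\mathrm{skew}X=\frac12(X-X^T)$, $\mathrm{dev}X=X-\frac13\mathrm{tr}(X)\mathbb{1}_3$ on $\mathbb{R}^{3\times3}$; for skew $A\in\mathbb{R}^{3\times3}$, $\mathrm{axl}(A)=(-A_{23},A_{13},-A_{12})^T$; $(a|b|c)$ is the matrix with columns $a,b,c$. $\omega\subset\mathbb{R}^2$ is a bounded Lipschitz domain, $y_0:\omega\to\mathbb{R}^3$ a regular parametrized surface of class $C^2$, $n_0=\frac{\partial_{x_1}y_0\times\partial_{x_2}y_0}{\|\partial_{x_1}y_0\times\partial_{x_2}y_0\|}$, $\nabla\Theta:=(\nabla y_0|n_0)$, $\mathrm{I}_{y_0}=(\nabla y_0)^T\nabla y_0$, $\mathrm{II}_{y_0}=-(\nabla y_0)^T\nabla n_0$, $\mathrm{L}_{y_0}=\mathrm{I}_{y_0}^{-1}\mathrm{II}_{y_0}$, $\mathrm{K}=\det\mathrm{L}_{y_0}$, $2\mathrm{H}=\mathrm{tr}\,\mathrm{L}_{y_0}$, $\kappa_1,\kappa_2$ the principal curvatures (eigenvalues of $\mathrm{L}_{y_0}$), $$\mathrm{B}_{y_0}=-(\nabla n_0|0)[\nabla\Theta]^{-1},\qquad \mathrm{C}_{y_0}=\det(\nabla\Theta)\,[\nabla\Theta]^{-T}\begin{pmatrix}0&1&0\\-1&0&0\\0&0&0\end{pmatrix}[\nabla\Theta]^{-1}.$$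 For a midsurface deformation $m:\omega\to\mathbb{R}^3$ and a microrotation $\overline{Q}_{e,s}:\omega\to\mathrm{SO}(3)$ (with weak first derivatives), $$\mathcal{E}_{m,s}=\overline{Q}_{e,s}^T(\nabla m|\overline{Q}_{e,s}\nabla\Theta e_3)[\nabla\Theta]^{-1}-\mathbb{1}_3,\qquad \mathcal{K}_{e,s}=\big(\mathrm{axl}(\overline{Q}_{e,s}^T\partial_{x_1}\overline{Q}_{e,s})|\mathrm{axl}(\overline{Q}_{e,s}^T\partial_{x_2}\overline{Q}_{e,s})|0\big)[\nabla\Theta]^{-1}.$$ The coercivity inequality is understood pointwise (a.e.) on $\omega$, for all such $(m,\overline{Q}_{e,s})$, with $a_1^+$ independent of $(m,\overline{Q}_{e,s})$. Energy functions: $W_{\rm shell}(X)=\mu\|\mathrm{sym}X\|^2+\mu_{\rm c}\|\mathrm{skew}X\|^2+\frac{\lambda\mu}{\lambda+2\mu}[\mathrm{tr}X]^2$, $\mathcal{W}_{\rm shell}(X,Y)=\mu\langle\mathrm{sym}X,\mathrm{sym}Y\rangle+\mu_{\rm c}\langle\mathrm{skew}X,\mathrm{skew}Y\rangle+\frac{\lambda\mu}{\lambda+2\mu}\mathrm{tr}(X)\mathrm{tr}(Y)$, $W_{\rm mp}(X)=\mu\|\mathrm{sym}X\|^2+\mu_{\rm c}\|\mathrm{skew}X\|^2+\frac\lambda2[\mathrm{tr}X]^2$, $W_{\rm curv}(X)=\mu L_{\rm c}^2\big(b_1\|\mathrm{dev\,sym}X\|^2+b_2\|\mathrm{skew}X\|^2+b_3[\mathrm{tr}X]^2\big)$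 with internal length $L_{\rm c}>0$. Writing $\mathcal{E}=\mathcal{E}_{m,s}$, $\mathcal{K}=\mathcal{K}_{e,s}$: $$W_{\rm memb}(\mathcal{E})=\big(h+\mathrm{K}\tfrac{h^3}{12}\big)W_{\rm shell}(\mathcal{E}),$$ $$W_{\rm memb,bend}(\mathcal{E},\mathcal{K})=\big(\tfrac{h^3}{12}-\mathrm{K}\tfrac{h^5}{80}\big)W_{\rm shell}(\mathcal{E}\mathrm{B}_{y_0}+\mathrm{C}_{y_0}\mathcal{K})-\tfrac{h^3}{3}\mathrm{H}\,\mathcal{W}_{\rm shell}(\mathcal{E},\mathcal{E}\mathrm{B}_{y_0}+\mathrm{C}_{y_0}\mathcal{K})$$ $$+\tfrac{h^3}{6}\mathcal{W}_{\rm shell}(\mathcal{E},(\mathcal{E}\mathrm{B}_{y_0}+\mathrm{C}_{y_0}\mathcal{K})\mathrm{B}_{y_0})+\tfrac{h^5}{80}W_{\rm mp}((\mathcal{E}\mathrm{B}_{y_0}+\mathrm{C}_{y_0}\mathcal{K})\mathrm{B}_{y_0}),$$ $$W_{\rm bend,curv}(\mathcal{K})=\big(h-\mathrm{K}\tfrac{h^3}{12}\big)W_{\rm curv}(\mathcal{K})+\big(\tfrac{h^3}{12}-\mathrm{K}\tfrac{h^5}{80}\big)W_{\rm curv}(\mathcal{K}\mathrm{B}_{y_0})+\tfrac{h^5}{80}W_{\rm curv}(\mathcal{K}\mathrm{B}_{y_0}^2).$$ *)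

theory Defs
  imports "HOL-Analysis.Analysis"
begin

subsection \<open>Domains, smoothness, weak derivatives\<close>

text \<open>Near each boundary point the set is, in suitable orthonormal coordinates, the strict
  subgraph of a Lipschitz function.\<close>

definition bounded_lipschitz_domain :: "(real^2) set \<Rightarrow> bool" where
  "bounded_lipschitz_domain \<omega> \<longleftrightarrow>
     open \<omega> \<and> connected \<omega> \<and> \<omega> \<noteq> {} \<and> bounded \<omega> \<and>
     (\<forall>p \<in> frontier \<omega>. \<exists>r>0. \<exists>u v. \<exists>g :: real \<Rightarrow> real. \<exists>L.
        norm u = 1 \<and> norm v = 1 \<and> u \<bullet> v = 0 \<and> L-lipschitz_on UNIV g \<and>
        \<omega> \<inter> ball p r = {x \<in> ball p r. x \<bullet> v < g (x \<bullet> u)})"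

definition partial :: "2 \<Rightarrow> (real^2 \<Rightarrow> 'b::real_normed_vector) \<Rightarrow> real^2 \<Rightarrow> 'b" where
  "partial i f x = frechet_derivative f (at x) (axis i 1)"

text \<open>Continuous differentiability of order \<open>k\<close>; only meant for open \<open>S\<close>.\<close>

primrec Ck_on :: "nat \<Rightarrow> (real^2) set \<Rightarrow> (real^2 \<Rightarrow> 'b::real_normed_vector) \<Rightarrow> bool" where
  "Ck_on 0 S f \<longleftrightarrow> continuous_on S f"
| "Ck_on (Suc k) S f \<longleftrightarrow> (\<forall>x\<in>S. f differentiable (at x)) \<and> (\<forall>i. Ck_on k S (partial i f))"

definition test_function :: "(real^2) set \<Rightarrow> (real^2 \<Rightarrow> real) \<Rightarrow> bool" where
  "test_function \<omega> \<phi> \<longleftrightarrow> (\<forall>k. Ck_on k UNIV \<phi>) \<and>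
     compact (closure {x. \<phi> x \<noteq> 0}) \<and> closure {x. \<phi> x \<noteq> 0} \<subseteq> \<omega>"

definition locally_integrable ::
    "(real^2) set \<Rightarrow> (real^2 \<Rightarrow> 'b::euclidean_space) \<Rightarrow> bool" where
  "locally_integrable \<omega> f \<longleftrightarrow>
     (\<forall>C. compact C \<and> C \<subseteq> \<omega> \<longrightarrow> set_integrable lebesgue C f)"

text \<open>\<open>Df i\<close> is a (representative of the) weak \<open>i\<close>-th partial derivative of \<open>f\<close> on \<open>\<omega>\<close>.\<close>

definition weak_derivs ::
    "(real^2) set \<Rightarrow> (real^2 \<Rightarrow> 'b::euclidean_space) \<Rightarrow> (2 \<Rightarrow> real^2 \<Rightarrow> 'b) \<Rightarrow> bool" where
  "weak_derivs \<omega> f Df \<longleftrightarrow> locally_integrable \<omega> f \<and>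
     (\<forall>i. locally_integrable \<omega> (Df i) \<and>
        (\<forall>\<phi>. test_function \<omega> \<phi> \<longrightarrow>
           set_lebesgue_integral lebesgue \<omega> (\<lambda>x. partial i \<phi> x *\<^sub>R f x) =
           - set_lebesgue_integral lebesgue \<omega> (\<lambda>x. \<phi> x *\<^sub>R Df i x)))"

subsection \<open>Tensor notation\<close>

text \<open>The library's \<open>norm\<close> and \<open>(\<bullet>)\<close> on \<^typ>\<open>real^3^3\<close> are the Frobenius norm
  and the inner product \<open>tr (X Y\<^sup>T)\<close>; see \<open>inner_eq_trace\<close> below.\<close>

lemma inner_eq_trace: "X \<bullet> Y = trace (X ** transpose Y)" for X Y :: "real^3^3"
  by (simp add: inner_vec_def trace_def matrix_matrix_mult_def transpose_def)

definition sym_part :: "real^3^3 \<Rightarrow> real^3^3" where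
  "sym_part X = (1/2) *\<^sub>R (X + transpose X)"

definition skew_part :: "real^3^3 \<Rightarrow> real^3^3" where
  "skew_part X = (1/2) *\<^sub>R (X - transpose X)"

definition dev :: "real^3^3 \<Rightarrow> real^3^3" where
  "dev X = X - (trace X / 3) *\<^sub>R mat 1"

definition axl :: "real^3^3 \<Rightarrow> real^3" where
  "axl A = vector [- A$2$3, A$1$3, - A$1$2]"

definition cols3 :: "real^3 \<Rightarrow> real^3 \<Rightarrow> real^3 \<Rightarrow> real^3^3" where
  "cols3 a b c = transpose (vector [a, b, c])"

subsection \<open>Geometry of the reference surface\<close>

definition regular_surface :: "(real^2) set \<Rightarrow> (real^2 \<Rightarrow> real^3) \<Rightarrow> bool" where
  "regular_surface \<omega> y0 \<longleftrightarrow> (\<forall>x\<in>\<omega>. rank (jacobian y0 (at x)) = 2)"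

definition normal :: "(real^2 \<Rightarrow> real^3) \<Rightarrow> real^2 \<Rightarrow> real^3" where
  "normal y0 x = (let c = cross3 (partial 1 y0 x) (partial 2 y0 x) in (1 / norm c) *\<^sub>R c)"

definition grad_Theta :: "(real^2 \<Rightarrow> real^3) \<Rightarrow> real^2 \<Rightarrow> real^3^3" where
  "grad_Theta y0 x = cols3 (partial 1 y0 x) (partial 2 y0 x) (normal y0 x)"

definition first_form :: "(real^2 \<Rightarrow> real^3) \<Rightarrow> real^2 \<Rightarrow> real^2^2" where
  "first_form y0 x = transpose (jacobian y0 (at x)) ** jacobian y0 (at x)"

definition second_form :: "(real^2 \<Rightarrow> real^3) \<Rightarrow> real^2 \<Rightarrow> real^2^2" where
  "second_form y0 x = - (transpose (jacobian y0 (at x)) ** jacobian (normal y0) (at x))"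

definition weingarten :: "(real^2 \<Rightarrow> real^3) \<Rightarrow> real^2 \<Rightarrow> real^2^2" where
  "weingarten y0 x = matrix_inv (first_form y0 x) ** second_form y0 x"

definition gauss_curv :: "(real^2 \<Rightarrow> real^3) \<Rightarrow> real^2 \<Rightarrow> real" where
  "gauss_curv y0 x = det (weingarten y0 x)"

definition mean_curv :: "(real^2 \<Rightarrow> real^3) \<Rightarrow> real^2 \<Rightarrow> real" where
  "mean_curv y0 x = trace (weingarten y0 x) / 2"

text \<open>The set equality determines the pair up to order also at umbilic points: a real
  \<open>2 \<times> 2\<close> matrix with exactly one real eigenvalue has it as a double root.\<close>

definition principal_curvatures ::
    "(real^2) set \<Rightarrow> (real^2 \<Rightarrow> real^3) \<Rightarrow> (real^2 \<Rightarrow> real) \<Rightarrow> (real^2 \<Rightarrow> real) \<Rightarrow> bool" where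
  "principal_curvatures \<omega> y0 \<kappa>1 \<kappa>2 \<longleftrightarrow>
     (\<forall>x\<in>\<omega>. {\<kappa>1 x, \<kappa>2 x} = {k. \<exists>v. v \<noteq> 0 \<and> weingarten y0 x *v v = k *\<^sub>R v})"

definition B_tensor :: "(real^2 \<Rightarrow> real^3) \<Rightarrow> real^2 \<Rightarrow> real^3^3" where
  "B_tensor y0 x =
     - (cols3 (partial 1 (normal y0) x) (partial 2 (normal y0) x) 0 ** matrix_inv (grad_Theta y0 x))"

definition C_tensor :: "(real^2 \<Rightarrow> real^3) \<Rightarrow> real^2 \<Rightarrow> real^3^3" where
  "C_tensor y0 x = det (grad_Theta y0 x) *\<^sub>R
     (transpose (matrix_inv (grad_Theta y0 x)) **
      vector [vector [0, 1, 0], vector [-1, 0, 0], vector [0, 0, 0]] **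
      matrix_inv (grad_Theta y0 x))"

subsection \<open>Strain measures\<close>

text \<open>\<open>Dm\<close> and \<open>DQ\<close> stand for the weak partial derivatives of \<open>m\<close> and \<open>Q\<close>.\<close>

definition shell_strain ::
    "(real^2 \<Rightarrow> real^3) \<Rightarrow> (2 \<Rightarrow> real^2 \<Rightarrow> real^3) \<Rightarrow> (real^2 \<Rightarrow> real^3^3) \<Rightarrow> real^2 \<Rightarrow> real^3^3" where
  "shell_strain y0 Dm Q x =
     transpose (Q x) ** cols3 (Dm 1 x) (Dm 2 x) (Q x *v (grad_Theta y0 x *v axis 3 1))
       ** matrix_inv (grad_Theta y0 x) - mat 1"

definition bending_curvature ::
    "(real^2 \<Rightarrow> real^3) \<Rightarrow> (real^2 \<Rightarrow> real^3^3) \<Rightarrow> (2 \<Rightarrow> real^2 \<Rightarrow> real^3^3) \<Rightarrow> real^2 \<Rightarrow> real^3^3" where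
  "bending_curvature y0 Q DQ x =
     cols3 (axl (transpose (Q x) ** DQ 1 x)) (axl (transpose (Q x) ** DQ 2 x)) 0
       ** matrix_inv (grad_Theta y0 x)"

subsection \<open>Energy densities\<close>

definition W_shell :: "real \<Rightarrow> real \<Rightarrow> real \<Rightarrow> real^3^3 \<Rightarrow> real" where
  "W_shell \<mu> \<mu>c lam X =
     \<mu> * (norm (sym_part X))\<^sup>2 + \<mu>c * (norm (skew_part X))\<^sup>2
       + lam * \<mu> / (lam + 2 * \<mu>) * (trace X)\<^sup>2"

definition W_shell_bilinear :: "real \<Rightarrow> real \<Rightarrow> real \<Rightarrow> real^3^3 \<Rightarrow> real^3^3 \<Rightarrow> real" where
  "W_shell_bilinear \<mu> \<mu>c lam X Y =
     \<mu> * (sym_part X \<bullet> sym_part Y) + \<mu>c * (skew_part X \<bullet> skew_part Y)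
       + lam * \<mu> / (lam + 2 * \<mu>) * trace X * trace Y"

definition W_mp :: "real \<Rightarrow> real \<Rightarrow> real \<Rightarrow> real^3^3 \<Rightarrow> real" where
  "W_mp \<mu> \<mu>c lam X =
     \<mu> * (norm (sym_part X))\<^sup>2 + \<mu>c * (norm (skew_part X))\<^sup>2 + lam / 2 * (trace X)\<^sup>2"

definition W_curv :: "real \<Rightarrow> real \<Rightarrow> real \<Rightarrow> real \<Rightarrow> real \<Rightarrow> real^3^3 \<Rightarrow> real" where
  "W_curv \<mu> Lc b1 b2 b3 X = \<mu> * Lc\<^sup>2 *
     (b1 * (norm (dev (sym_part X)))\<^sup>2 + b2 * (norm (skew_part X))\<^sup>2 + b3 * (trace X)\<^sup>2)"

text \<open>In the next definitions \<open>K\<close>, \<open>H\<close>, \<open>B\<close>, \<open>C\<close> are the values at one point of the Gauss and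
  mean curvature and of the two surface tensors, \<open>E\<close> and \<open>R\<close> those of the shell strain and of
  the bending-curvature tensor.\<close>

definition W_memb :: "real \<Rightarrow> real \<Rightarrow> real \<Rightarrow> real \<Rightarrow> real \<Rightarrow> real^3^3 \<Rightarrow> real" where
  "W_memb h \<mu> \<mu>c lam K E = (h + K * h^3 / 12) * W_shell \<mu> \<mu>c lam E"

definition W_memb_bend ::
    "real \<Rightarrow> real \<Rightarrow> real \<Rightarrow> real \<Rightarrow> real \<Rightarrow> real \<Rightarrow> real^3^3 \<Rightarrow> real^3^3 \<Rightarrow>
     real^3^3 \<Rightarrow> real^3^3 \<Rightarrow> real" where
  "W_memb_bend h \<mu> \<mu>c lam K H B C E R =
     (h^3 / 12 - K * h^5 / 80) * W_shell \<mu> \<mu>c lam (E ** B + C ** R)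
     - h^3 / 3 * H * W_shell_bilinear \<mu> \<mu>c lam E (E ** B + C ** R)
     + h^3 / 6 * W_shell_bilinear \<mu> \<mu>c lam E ((E ** B + C ** R) ** B)
     + h^5 / 80 * W_mp \<mu> \<mu>c lam ((E ** B + C ** R) ** B)"

definition W_bend_curv ::
    "real \<Rightarrow> real \<Rightarrow> real \<Rightarrow> real \<Rightarrow> real \<Rightarrow> real \<Rightarrow> real \<Rightarrow> real^3^3 \<Rightarrow> real^3^3 \<Rightarrow> real" where
  "W_bend_curv h \<mu> Lc b1 b2 b3 K B R =
     (h - K * h^3 / 12) * W_curv \<mu> Lc b1 b2 b3 R
     + (h^3 / 12 - K * h^5 / 80) * W_curv \<mu> Lc b1 b2 b3 (R ** B)
     + h^5 / 80 * W_curv \<mu> Lc b1 b2 b3 (R ** B ** B)"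

definition shell_energy ::
    "real \<Rightarrow> real \<Rightarrow> real \<Rightarrow> real \<Rightarrow> real \<Rightarrow> real \<Rightarrow> real \<Rightarrow> real \<Rightarrow>
     (real^2 \<Rightarrow> real^3) \<Rightarrow> real^2 \<Rightarrow> real^3^3 \<Rightarrow> real^3^3 \<Rightarrow> real" where
  "shell_energy h \<mu> \<mu>c lam Lc b1 b2 b3 y0 x E R =
     W_memb h \<mu> \<mu>c lam (gauss_curv y0 x) E
     + W_memb_bend h \<mu> \<mu>c lam (gauss_curv y0 x) (mean_curv y0 x) (B_tensor y0 x) (C_tensor y0 x) E R
     + W_bend_curv h \<mu> Lc b1 b2 b3 (gauss_curv y0 x) (B_tensor y0 x) R"

end

theory Submission
  imports Defs
begin

text \<open>The coupling terms are absorbed by completing squares in the inner product of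
  \<open>W_shell\<close>, treating \<open>Y = E B + C R\<close> and \<open>Y B\<close> as independent of \<open>E\<close>. This leaves the factor
  \<open>h (4/9 - a/12 - a/(36 (1/12 - a/80)))\<close> in front of \<open>W_shell E\<close>, where \<open>a = \<alpha>\<^sup>2\<close> bounds both
  \<open>h\<^sup>2 \<bar>K\<bar>\<close> and \<open>(h H)\<^sup>2\<close>; for \<open>a < 1\<close> it is positive
  iff \<open>9 a\<^sup>2 - 348 a + 320 > 0\<close>, and the smaller root of that quadratic is
  \<open>2/3 (29 - \<surd>761)\<close>.\<close>

section \<open>Trace and determinant from the eigenvalues of a 2 by 2 matrix\<close>

lemma eigenvalue_iff_charpoly_2:
  fixes A :: "real^2^2"
  shows "(\<exists>v. v \<noteq> 0 \<and> A *v v = k *\<^sub>R v) \<longleftrightarrow> k\<^sup>2 - trace A * k + det A = 0"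
proof -
  have "A *v v = k *\<^sub>R v \<longleftrightarrow> (A - k *\<^sub>R mat 1) *v v = 0" for v
    by (simp add: matrix_vector_mult_diff_rdistrib scaleR_matrix_vector_assoc [symmetric])
  then have "(\<exists>v. v \<noteq> 0 \<and> A *v v = k *\<^sub>R v) \<longleftrightarrow> (\<exists>v. v \<noteq> 0 \<and> (A - k *\<^sub>R mat 1) *v v = 0)"
    by simp
  also have "\<dots> \<longleftrightarrow> \<not> invertible (A - k *\<^sub>R mat 1)"
    by (auto simp: invertible_left_inverse matrix_left_invertible_ker)
  also have "\<dots> \<longleftrightarrow> det (A - k *\<^sub>R mat 1) = 0"
    by (simp add: invertible_det_nz)
  also have "det (A - k *\<^sub>R mat 1) = k\<^sup>2 - trace A * k + det A"
    by (simp add: det_2 trace_def sum_2 mat_def power2_eq_square algebra_simps)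
  finally show ?thesis .
qed

text \<open>Vieta's formulas. The set equality makes \<open>k1\<close> and \<open>k2\<close> the
  only roots of the characteristic polynomial; the case \<open>k1 = k2\<close> must still yield a
  double root.\<close>

lemma trace_det_eq_eigenvalues_2:
  fixes A :: "real^2^2"
  assumes "{k1, k2} = {k. \<exists>v. v \<noteq> 0 \<and> A *v v = k *\<^sub>R v}"
  shows "trace A = k1 + k2" and "det A = k1 * k2"
proof -
  have root: "k \<in> {k1, k2} \<longleftrightarrow> k\<^sup>2 - trace A * k + det A = 0" for k
    unfolding assms by (simp add: eigenvalue_iff_charpoly_2)
  have r1: "k1\<^sup>2 - trace A * k1 + det A = 0" and r2: "k2\<^sup>2 - trace A * k2 + det A = 0"
    using root by blast+
  show tr: "trace A = k1 + k2"
  proof (cases "k1 = k2")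
    case True
    \<comment> \<open>The companion root \<open>trace A - k1\<close> is again a root, so with a
      one-element root set it has to be \<open>k1\<close> itself.\<close>
    have "(trace A - k1)\<^sup>2 - trace A * (trace A - k1) + det A = 0"
      using r1 by (simp add: power2_eq_square algebra_simps)
    then show ?thesis using root [of "trace A - k1"] True by auto
  next
    case False
    have "(k1 - k2) * (k1 + k2 - trace A) = 0"
      using r1 r2 by (simp add: power2_eq_square algebra_simps)
    then show ?thesis using False by simp
  qed
  show "det A = k1 * k2"
    using r1 by (simp add: tr power2_eq_square algebra_simps)
qed

section \<open>Positive definiteness of the quadratic forms\<close>

lemma norm_sym_skew: "(norm X)\<^sup>2 = (norm (sym_part X))\<^sup>2 + (norm (skew_part X))\<^sup>2"
  unfolding sym_part_def skew_part_def power2_norm_eq_inner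
  by (simp add: inner_vec_def sum_3 transpose_def field_simps)

lemma norm_dev: "(norm X)\<^sup>2 = (norm (dev X))\<^sup>2 + (trace X)\<^sup>2 / 3"
  unfolding dev_def power2_norm_eq_inner
  by (simp add: inner_vec_def sum_3 trace_def mat_def power2_eq_square field_simps)

lemma trace_sym_part [simp]: "trace (sym_part X) = trace X"
  by (simp add: trace_def sym_part_def transpose_def sum_3)

text \<open>Only a negative trace coefficient can hurt. Its worst case is a multiple of the
  identity, where the symmetric part is weighted by \<open>\<mu> + 3 * d\<close>; the assumption
  \<open>2 * lam + \<mu> > 0\<close> makes this positive.\<close>

lemma W_shell_coercive:
  assumes "\<mu> > 0" "\<mu>c > 0" "2 * lam + \<mu> > 0"
  obtains c where "c > 0" "\<And>X. W_shell \<mu> \<mu>c lam X \<ge> c * (norm X)\<^sup>2"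
proof -
  define d where "d = lam * \<mu> / (lam + 2 * \<mu>)"
  define e where "e = min \<mu> (\<mu> + 3 * d)"
  have "lam + 2 * \<mu> > 0" using assms by simp
  then have "\<mu> + 3 * d = 2 * \<mu> * (2 * lam + \<mu>) / (lam + 2 * \<mu>)"
    by (simp add: d_def field_simps)
  then have "\<mu> + 3 * d > 0" using assms \<open>lam + 2 * \<mu> > 0\<close> by simp
  then have e: "e > 0" using assms by (simp add: e_def)
  show thesis
  proof
    show "min e \<mu>c > 0" using e assms by simp
    fix X
    define s where "s = (norm (sym_part X))\<^sup>2"
    define k where "k = (norm (skew_part X))\<^sup>2"
    \<comment> \<open>The trace bound comes from dropping the deviatoric term in
      \<open>norm_dev\<close>.\<close>
    have t: "(trace X)\<^sup>2 \<le> 3 * s" and s: "0 \<le> s" and k: "0 \<le> k"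
      using norm_dev [of "sym_part X"] by (simp_all add: s_def k_def)
    have "e * s \<le> \<mu> * s + d * (trace X)\<^sup>2"
    proof (cases "d \<ge> 0")
      case True
      have "e * s \<le> \<mu> * s" using s by (intro mult_right_mono) (auto simp: e_def)
      then show ?thesis using True by (simp add: add_increasing2)
    next
      case False
      have "e * s \<le> (\<mu> + 3 * d) * s" using s by (intro mult_right_mono) (auto simp: e_def)
      moreover have "d * (3 * s) \<le> d * (trace X)\<^sup>2"
        using False t by (intro mult_left_mono_neg) auto
      ultimately show ?thesis by (simp add: algebra_simps)
    qed
    moreover have "min e \<mu>c * s \<le> e * s" "min e \<mu>c * k \<le> \<mu>c * k"
      using s k by (auto intro: mult_right_mono)
    ultimately show "min e \<mu>c * (norm X)\<^sup>2 \<le> W_shell \<mu> \<mu>c lam X"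
      unfolding W_shell_def norm_sym_skew [of X] s_def [symmetric] k_def [symmetric]
        d_def [symmetric] by (simp add: distrib_left)
  qed
qed

text \<open>The deviatoric symmetric, skew and spherical parts are orthogonal. The spherical part
  has squared norm \<open>(trace X)\<^sup>2 / 3\<close>, hence the factor 3 next to
  \<open>b3\<close> in the minimum.\<close>

lemma W_curv_coercive:
  assumes "\<mu> > 0" "Lc > 0" "b1 > 0" "b2 > 0" "b3 > 0"
  obtains c where "c > 0" "\<And>X. W_curv \<mu> Lc b1 b2 b3 X \<ge> c * (norm X)\<^sup>2"
proof
  define b where "b = min b1 (min b2 (3 * b3))"
  show "\<mu> * Lc\<^sup>2 * b > 0" using assms by (simp add: b_def)
  fix X
  have "b * (norm (dev (sym_part X)))\<^sup>2 \<le> b1 * (norm (dev (sym_part X)))\<^sup>2"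
    "b * (norm (skew_part X))\<^sup>2 \<le> b2 * (norm (skew_part X))\<^sup>2"
    "b * (trace X)\<^sup>2 \<le> (3 * b3) * (trace X)\<^sup>2"
    by (intro mult_right_mono; simp add: b_def)+
  then have "b * (norm X)\<^sup>2 \<le> b1 * (norm (dev (sym_part X)))\<^sup>2 +
      b2 * (norm (skew_part X))\<^sup>2 + b3 * (trace X)\<^sup>2"
    unfolding norm_sym_skew [of X] norm_dev [of "sym_part X"] by (simp add: algebra_simps)
  then show "\<mu> * Lc\<^sup>2 * b * (norm X)\<^sup>2 \<le> W_curv \<mu> Lc b1 b2 b3 X"
    using assms unfolding W_curv_def mult.assoc by (intro mult_left_mono) auto
qed

section \<open>Comparison and completion of squares\<close>

text \<open>The two forms differ only in the trace coefficient. The estimate lets the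
  \<open>W_mp\<close> term take part in a completion of squares for \<open>W_shell\<close>.\<close>

lemma W_shell_le_W_mp:
  assumes "lam + 2 * \<mu> > 0"
  shows "W_shell \<mu> \<mu>c lam X \<le> W_mp \<mu> \<mu>c lam X"
proof -
  have "lam / 2 - lam * \<mu> / (lam + 2 * \<mu>) = lam\<^sup>2 / (2 * (lam + 2 * \<mu>))"
    using assms by (simp add: field_simps power2_eq_square)
  also have "\<dots> \<ge> 0" using assms by simp
  finally show ?thesis
    unfolding W_shell_def W_mp_def by (intro add_left_mono mult_right_mono) auto
qed

lemma W_shell_combination:
  "W_shell \<mu> \<mu>c lam (s *\<^sub>R X + t *\<^sub>R Y) =
     s\<^sup>2 * W_shell \<mu> \<mu>c lam X + 2 * s * t * W_shell_bilinear \<mu> \<mu>c lam X Y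
       + t\<^sup>2 * W_shell \<mu> \<mu>c lam Y"
proof -
  have "sym_part (s *\<^sub>R X + t *\<^sub>R Y) = s *\<^sub>R sym_part X + t *\<^sub>R sym_part Y"
    "skew_part (s *\<^sub>R X + t *\<^sub>R Y) = s *\<^sub>R skew_part X + t *\<^sub>R skew_part Y"
    by (simp_all add: sym_part_def skew_part_def transpose_def vec_eq_iff algebra_simps)
  moreover have "trace (s *\<^sub>R X + t *\<^sub>R Y) = s * trace X + t * trace Y"
    by (simp add: trace_def sum_3 algebra_simps)
  moreover have "(norm (s *\<^sub>R A + t *\<^sub>R B))\<^sup>2 =
      s\<^sup>2 * (norm A)\<^sup>2 + 2 * s * t * (A \<bullet> B) + t\<^sup>2 * (norm B)\<^sup>2"
    for A B :: "real^3^3"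
    unfolding power2_norm_eq_inner
    by (simp add: inner_add inner_commute [of B A] power2_eq_square algebra_simps)
  ultimately show ?thesis
    by (simp add: W_shell_def W_shell_bilinear_def power2_eq_square algebra_simps)
qed

text \<open>Expand the nonnegative value of the form at
  \<open>(t / 2) *\<^sub>R X + q *\<^sub>R Y\<close> and divide by \<open>q\<close>. The right-hand
  side is the price, paid in \<open>X\<close>, for absorbing a coupling of strength
  \<open>t\<close>.\<close>

lemma W_shell_complete_square:
  assumes "\<And>Z. W_shell \<mu> \<mu>c lam Z \<ge> 0" and "q > 0"
  shows "q * W_shell \<mu> \<mu>c lam Y + t * W_shell_bilinear \<mu> \<mu>c lam X Y
    \<ge> - (t\<^sup>2 / (4 * q)) * W_shell \<mu> \<mu>c lam X"
proof -
  have "0 \<le> W_shell \<mu> \<mu>c lam ((t / 2) *\<^sub>R X + q *\<^sub>R Y) / q"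
    using assms by simp
  also have "\<dots> = (t\<^sup>2 / (4 * q)) * W_shell \<mu> \<mu>c lam X + t * W_shell_bilinear \<mu> \<mu>c lam X Y
      + q * W_shell \<mu> \<mu>c lam Y"
    using \<open>q > 0\<close> unfolding W_shell_combination by (simp add: field_simps power2_eq_square)
  finally show ?thesis by simp
qed

section \<open>The numerical threshold for \<open>\<alpha>\<close>\<close>

lemma threshold_bounds:
  fixes \<alpha> :: real
  assumes "0 < \<alpha>" and "\<alpha> < sqrt (2/3 * (29 - sqrt 761))"
  shows "\<alpha>\<^sup>2 < 1" and "4/9 - \<alpha>\<^sup>2 / 12 - \<alpha>\<^sup>2 / (36 * (1/12 - \<alpha>\<^sup>2 / 80)) > 0"
proof -
  define r where "r = sqrt 761"
  have r2: "r * r = 761" by (simp add: r_def)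
  \<comment> \<open>The value 55/2 is chosen because \<open>2/3 * (29 - 55/2) = 1\<close>, which
    gives \<open>\<alpha>\<^sup>2 < 1\<close>. The upper bound 29 keeps the radicand
    positive.\<close>
  have "55/2 < sqrt 761" by (rule real_less_rsqrt) (simp add: power2_eq_square)
  moreover have "sqrt 761 < 29" by (rule real_less_lsqrt) (simp_all add: power2_eq_square)
  ultimately have r: "55/2 < r" "r < 29" by (simp_all add: r_def)
  have "\<alpha>\<^sup>2 < (sqrt (2/3 * (29 - r)))\<^sup>2"
    using assms by (intro power_strict_mono) (auto simp: r_def)
  also have "\<dots> = 2/3 * (29 - r)" using r by simp
  finally have a: "\<alpha>\<^sup>2 < 2/3 * (29 - r)" .
  with r show a1: "\<alpha>\<^sup>2 < 1" by simp
  \<comment> \<open>Since \<open>\<alpha>\<^sup>2\<close> lies below both roots, the product of the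
    two factors is positive; multiplied by 9 it is the quadratic in the next line.\<close>
  have "(2/3 * (29 - r) - \<alpha>\<^sup>2) * (2/3 * (29 + r) - \<alpha>\<^sup>2) > 0"
    using a r a1 by (intro mult_pos_pos) auto
  then have *: "9 * (\<alpha>\<^sup>2 * \<alpha>\<^sup>2) - 348 * \<alpha>\<^sup>2 + 320 > 0"
    using r2 by (simp add: algebra_simps)
  define q where "q = 1/12 - \<alpha>\<^sup>2 / 80"
  have q: "q > 0" using a1 by (simp add: q_def)
  have "(4/9 - \<alpha>\<^sup>2 / 12) * (36 * q) - \<alpha>\<^sup>2 = (9 * (\<alpha>\<^sup>2 * \<alpha>\<^sup>2) - 348 * \<alpha>\<^sup>2 + 320) / 240"
    by (simp add: q_def field_simps)
  then have "\<alpha>\<^sup>2 / (36 * q) < 4/9 - \<alpha>\<^sup>2 / 12"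
    using * q by (simp add: divide_less_eq)
  then show "4/9 - \<alpha>\<^sup>2 / 12 - \<alpha>\<^sup>2 / (36 * (1/12 - \<alpha>\<^sup>2 / 80)) > 0"
    by (simp add: q_def)
qed

section \<open>Lower bounds for the membrane-bending and curvature energies\<close>

lemma W_memb_plus_W_memb_bend_ge:
  assumes nonneg: "\<And>Z. W_shell \<mu> \<mu>c lam Z \<ge> 0" and lm: "lam + 2 * \<mu> > 0"
    and h: "h > 0" and K: "h\<^sup>2 * \<bar>K\<bar> \<le> a" and H: "(h * H)\<^sup>2 \<le> a" and a1: "a < 1"
  shows "W_memb h \<mu> \<mu>c lam K E + W_memb_bend h \<mu> \<mu>c lam K H B C E R
    \<ge> h * (4/9 - a / 12 - a / (36 * (1/12 - a / 80))) * W_shell \<mu> \<mu>c lam E"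
proof -
  define Y where "Y = E ** B + C ** R"
  \<comment> \<open>\<open>h^3 * q\<close> is the least value that the coefficient of
    \<open>W_shell\<close> at \<open>Y\<close> can take when
    \<open>h\<^sup>2 * K \<le> a\<close>.\<close>
  define q where "q = 1/12 - a / 80"
  define w where "w = W_shell \<mu> \<mu>c lam"
  define b where "b = W_shell_bilinear \<mu> \<mu>c lam"
  have w0: "w Z \<ge> 0" for Z using nonneg by (simp add: w_def)
  have q: "q > 0" using a1 by (simp add: q_def)
  have Ka: "- a \<le> h\<^sup>2 * K" "h\<^sup>2 * K \<le> a"
  proof -
    have "\<bar>h\<^sup>2 * K\<bar> \<le> a" using K by (simp add: abs_mult)
    then show "- a \<le> h\<^sup>2 * K" "h\<^sup>2 * K \<le> a" by simp_all
  qed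
  \<comment> \<open>Absorbing this coupling costs 5/9 of the leading membrane coefficient
    \<open>h\<close>, which leaves the 4/9 of the claim.\<close>
  have "h^5 / 80 * w (Y ** B) + h^3 / 6 * b E (Y ** B) \<ge> - ((h^3 / 6)\<^sup>2 / (4 * (h^5 / 80))) * w E"
    unfolding w_def b_def using h by (intro W_shell_complete_square nonneg) simp
  also have "(h^3 / 6)\<^sup>2 / (4 * (h^5 / 80)) = 5/9 * h"
    using h by (simp add: field_simps eval_nat_numeral)
  finally have yb: "h^5 / 80 * w (Y ** B) + h^3 / 6 * b E (Y ** B) \<ge> - (5/9 * h * w E)" by simp
  have y: "h^3 * q * w Y + (- (h^3 / 3 * H)) * b E Y \<ge> - ((- (h^3 / 3 * H))\<^sup>2 / (4 * (h^3 * q))) * w E"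
    unfolding w_def b_def using h q by (intro W_shell_complete_square nonneg) simp
  have "(- (h^3 / 3 * H))\<^sup>2 / (4 * (h^3 * q)) = h * ((h * H)\<^sup>2 / (36 * q))"
    using h q by (simp add: field_simps eval_nat_numeral)
  \<comment> \<open>The mean curvature enters the estimate only here, through
    \<open>(h * H)\<^sup>2 \<le> a\<close>.\<close>
  also have "\<dots> \<le> h * (a / (36 * q))"
    using h q H by (intro mult_left_mono divide_right_mono) auto
  finally have "(- (h^3 / 3 * H))\<^sup>2 / (4 * (h^3 * q)) * w E \<le> h * (a / (36 * q)) * w E"
    using w0 by (intro mult_right_mono)
  with y have y': "h^3 * q * w Y - h^3 / 3 * H * b E Y \<ge> - (h * (a / (36 * q)) * w E)"
    by simp
  have "h * (1 - a / 12) \<le> h * (1 + h\<^sup>2 * K / 12)"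
    using h Ka by (intro mult_left_mono) auto
  also have "\<dots> = h + K * h^3 / 12" by (simp add: algebra_simps eval_nat_numeral)
  finally have x: "h * (1 - a / 12) * w E \<le> (h + K * h^3 / 12) * w E"
    using w0 by (intro mult_right_mono)
  have "h^3 * q \<le> h^3 * (1/12 - h\<^sup>2 * K / 80)"
    using h Ka by (intro mult_left_mono) (auto simp: q_def)
  also have "\<dots> = h^3 / 12 - K * h^5 / 80" by (simp add: algebra_simps eval_nat_numeral)
  finally have y2: "h^3 * q * w Y \<le> (h^3 / 12 - K * h^5 / 80) * w Y"
    using w0 by (intro mult_right_mono)
  have z: "h^5 / 80 * w (Y ** B) \<le> h^5 / 80 * W_mp \<mu> \<mu>c lam (Y ** B)"
    unfolding w_def using h by (intro mult_left_mono W_shell_le_W_mp lm) simp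
  have "h * (4/9 - a / 12 - a / (36 * q)) * w E =
      h * (1 - a / 12) * w E - 5/9 * h * w E - h * (a / (36 * q)) * w E"
    by (simp add: algebra_simps)
  also have "\<dots> \<le> W_memb h \<mu> \<mu>c lam K E + W_memb_bend h \<mu> \<mu>c lam K H B C E R"
    unfolding W_memb_def W_memb_bend_def Y_def [symmetric] w_def [symmetric] b_def [symmetric]
    using x y' y2 z yb by linarith
  finally show ?thesis by (simp add: q_def w_def)
qed

lemma W_bend_curv_ge:
  assumes nonneg: "\<And>Z. W_curv \<mu> Lc b1 b2 b3 Z \<ge> 0"
    and h: "h > 0" and K: "h\<^sup>2 * \<bar>K\<bar> < 1"
  shows "W_bend_curv h \<mu> Lc b1 b2 b3 K B R \<ge> h / 2 * W_curv \<mu> Lc b1 b2 b3 R"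
proof -
  have "\<bar>h\<^sup>2 * K\<bar> < 1" using K by (simp add: abs_mult)
  then have K1: "h\<^sup>2 * K < 1" by simp
  then have "1/2 \<le> 1 - h\<^sup>2 * K / 12" by linarith
  then have "h * (1/2) \<le> h * (1 - h\<^sup>2 * K / 12)" using h by (intro mult_left_mono) simp_all
  then have 1: "h / 2 \<le> h - K * h^3 / 12" by (simp add: algebra_simps eval_nat_numeral)
  have "0 \<le> 1/12 - h\<^sup>2 * K / 80" using K1 by linarith
  then have "0 \<le> h^3 * (1/12 - h\<^sup>2 * K / 80)" using h by (intro mult_nonneg_nonneg) simp_all
  then have 2: "0 \<le> h^3 / 12 - K * h^5 / 80" by (simp add: algebra_simps eval_nat_numeral)
  have "h / 2 * W_curv \<mu> Lc b1 b2 b3 R \<le> (h - K * h^3 / 12) * W_curv \<mu> Lc b1 b2 b3 R"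
    using 1 nonneg by (intro mult_right_mono)
  then show ?thesis
    unfolding W_bend_curv_def using 2 h nonneg by (simp add: add_increasing2)
qed

section \<open>From principal curvatures to Gauss and mean curvature\<close>

lemma principal_curvature_bounds:
  assumes pc: "principal_curvatures \<omega> y0 \<kappa>1 \<kappa>2" and x: "x \<in> \<omega>" and h: "h > 0"
    and "h * \<bar>\<kappa>1 x\<bar> \<le> \<alpha>" and "h * \<bar>\<kappa>2 x\<bar> \<le> \<alpha>"
  shows "h\<^sup>2 * \<bar>gauss_curv y0 x\<bar> \<le> \<alpha>\<^sup>2" and "(h * mean_curv y0 x)\<^sup>2 \<le> \<alpha>\<^sup>2"
proof -
  have "{\<kappa>1 x, \<kappa>2 x} = {k. \<exists>v. v \<noteq> 0 \<and> weingarten y0 x *v v = k *\<^sub>R v}"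
    using pc x by (simp add: principal_curvatures_def)
  note tr = trace_det_eq_eigenvalues_2 [OF this]
  have "h\<^sup>2 * \<bar>gauss_curv y0 x\<bar> = (h * \<bar>\<kappa>1 x\<bar>) * (h * \<bar>\<kappa>2 x\<bar>)"
    by (simp add: gauss_curv_def tr abs_mult power2_eq_square)
  also have "\<dots> \<le> \<alpha> * \<alpha>"
  proof (rule mult_mono)
    have "0 \<le> h * \<bar>\<kappa>1 x\<bar>" using h by simp
    then show "0 \<le> \<alpha>" using assms(4) by linarith
  qed (use assms in auto)
  finally show "h\<^sup>2 * \<bar>gauss_curv y0 x\<bar> \<le> \<alpha>\<^sup>2" by (simp add: power2_eq_square)
  have "\<bar>h * mean_curv y0 x\<bar> = h * \<bar>\<kappa>1 x + \<kappa>2 x\<bar> / 2"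
    using h by (simp add: mean_curv_def tr abs_mult)
  also have "\<dots> \<le> h * (\<bar>\<kappa>1 x\<bar> + \<bar>\<kappa>2 x\<bar>) / 2"
    using h by (intro divide_right_mono mult_left_mono) auto
  also have "\<dots> \<le> \<alpha>" using assms by (simp add: distrib_left)
  finally show "(h * mean_curv y0 x)\<^sup>2 \<le> \<alpha>\<^sup>2"
    by (simp add: abs_le_square_iff [symmetric])
qed

section \<open>Uniform coercivity of the full energy density\<close>

theorem propositionA2:
  fixes \<omega> :: "(real^2) set" and y0 :: "real^2 \<Rightarrow> real^3"
    and \<kappa>1 \<kappa>2 :: "real^2 \<Rightarrow> real"
    and h \<alpha> \<mu> \<mu>c lam Lc b1 b2 b3 :: real
  assumes "bounded_lipschitz_domain \<omega>"
    and "Ck_on 2 \<omega> y0" and "regular_surface \<omega> y0"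
    and "principal_curvatures \<omega> y0 \<kappa>1 \<kappa>2"
    and "h > 0"
    and "ereal h * max (SUP x\<in>\<omega>. ereal \<bar>\<kappa>1 x\<bar>) (SUP x\<in>\<omega>. ereal \<bar>\<kappa>2 x\<bar>) < ereal \<alpha>"
    and "\<alpha> < sqrt (2/3 * (29 - sqrt 761))"
    and "\<mu> > 0" and "\<mu>c > 0" and "2 * lam + \<mu> > 0"
    and "b1 > 0" and "b2 > 0" and "b3 > 0" and "Lc > 0"
  shows "\<exists>a1 > 0. \<forall>m Dm Q DQ.
           weak_derivs \<omega> m Dm \<and> weak_derivs \<omega> Q DQ \<and> (\<forall>x\<in>\<omega>. rotation_matrix (Q x)) \<longrightarrow>
           (AE x in lebesgue_on \<omega>.
              shell_energy h \<mu> \<mu>c lam Lc b1 b2 b3 y0 x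
                (shell_strain y0 Dm Q x) (bending_curvature y0 Q DQ x)
              \<ge> a1 * ((norm (shell_strain y0 Dm Q x))\<^sup>2 + (norm (bending_curvature y0 Q DQ x))\<^sup>2))"
proof -
  \<comment> \<open>The suprema are taken in the extended reals, so unbounded curvatures would give
    infinity and violate the smallness assumption.\<close>
  define M where "M = max (SUP x\<in>\<omega>. ereal \<bar>\<kappa>1 x\<bar>) (SUP x\<in>\<omega>. ereal \<bar>\<kappa>2 x\<bar>)"
  have small: "h * k < \<alpha>" if "ereal k \<le> M" for k
  proof -
    have "ereal h * ereal k \<le> ereal h * M"
      using that \<open>h > 0\<close> by (intro ereal_mult_left_mono) auto
    also have "\<dots> < ereal \<alpha>" using assms(6) by (simp add: M_def)
    finally show ?thesis by simp
  qed
  have \<kappa>: "h * \<bar>\<kappa>1 x\<bar> < \<alpha>" "h * \<bar>\<kappa>2 x\<bar> < \<alpha>" if "x \<in> \<omega>" for x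
    using that by (auto intro!: small simp: M_def le_max_iff_disj intro: SUP_upper)
  \<comment> \<open>Positivity of \<open>\<alpha>\<close> is read off at any one point of the
    nonempty domain.\<close>
  obtain x0 where "x0 \<in> \<omega>" using assms(1) by (auto simp: bounded_lipschitz_domain_def)
  have "0 \<le> h * \<bar>\<kappa>1 x0\<bar>" using \<open>h > 0\<close> by simp
  with \<kappa>(1) [OF \<open>x0 \<in> \<omega>\<close>] have "0 < \<alpha>" by linarith
  note \<alpha> = threshold_bounds [OF \<open>0 < \<alpha>\<close> assms(7)]
  define \<delta> where "\<delta> = 4/9 - \<alpha>\<^sup>2 / 12 - \<alpha>\<^sup>2 / (36 * (1/12 - \<alpha>\<^sup>2 / 80))"
  have "\<delta> > 0" using \<alpha>(2) by (simp add: \<delta>_def)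
  obtain cs where cs: "cs > 0" "\<And>X. W_shell \<mu> \<mu>c lam X \<ge> cs * (norm X)\<^sup>2"
    using W_shell_coercive [OF \<open>\<mu> > 0\<close> \<open>\<mu>c > 0\<close> \<open>2 * lam + \<mu> > 0\<close>] by blast
  obtain cc where cc: "cc > 0" "\<And>X. W_curv \<mu> Lc b1 b2 b3 X \<ge> cc * (norm X)\<^sup>2"
    using W_curv_coercive [OF \<open>\<mu> > 0\<close> \<open>Lc > 0\<close> \<open>b1 > 0\<close> \<open>b2 > 0\<close> \<open>b3 > 0\<close>] by blast
  have shell0: "W_shell \<mu> \<mu>c lam X \<ge> 0" for X
    using cs(2) [of X] cs(1) by (meson mult_nonneg_nonneg less_imp_le order_trans zero_le_power2)
  have curv0: "W_curv \<mu> Lc b1 b2 b3 X \<ge> 0" for X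
    using cc(2) [of X] cc(1) by (meson mult_nonneg_nonneg less_imp_le order_trans zero_le_power2)
  \<comment> \<open>The constant is built from \<open>h\<close>, \<open>\<alpha>\<close> and the
    constitutive coefficients alone.\<close>
  define a where "a = min (h * \<delta> * cs) (h / 2 * cc)"
  have "a > 0" using \<open>h > 0\<close> \<open>\<delta> > 0\<close> cs(1) cc(1) by (simp add: a_def)
  \<comment> \<open>Proving the bound for arbitrary matrices \<open>E\<close> and \<open>R\<close>
    at every point makes \<open>a\<close> independent of the deformation and the
    microrotation.\<close>
  have main: "shell_energy h \<mu> \<mu>c lam Lc b1 b2 b3 y0 x E R \<ge> a * ((norm E)\<^sup>2 + (norm R)\<^sup>2)"
    if "x \<in> \<omega>" for x E R
  proof -
    note KH = principal_curvature_bounds [OF assms(4) that \<open>h > 0\<close>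
        less_imp_le [OF \<kappa>(1) [OF that]] less_imp_le [OF \<kappa>(2) [OF that]]]
    have "lam + 2 * \<mu> > 0" using \<open>\<mu> > 0\<close> \<open>2 * lam + \<mu> > 0\<close> by simp
    note mb = W_memb_plus_W_memb_bend_ge [OF shell0 this \<open>h > 0\<close> KH \<alpha>(1), folded \<delta>_def]
    note bc = W_bend_curv_ge [where B = "B_tensor y0 x" and R = R,
        OF curv0 \<open>h > 0\<close> le_less_trans [OF KH(1) \<alpha>(1)]]
    have "a * (norm E)\<^sup>2 \<le> h * \<delta> * (cs * (norm E)\<^sup>2)"
      unfolding mult.assoc [symmetric] by (intro mult_right_mono) (auto simp: a_def)
    also have "\<dots> \<le> h * \<delta> * W_shell \<mu> \<mu>c lam E"
      using cs(2) \<open>h > 0\<close> \<open>\<delta> > 0\<close> by (intro mult_left_mono) auto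
    finally have E: "a * (norm E)\<^sup>2 \<le> h * \<delta> * W_shell \<mu> \<mu>c lam E" .
    have "a * (norm R)\<^sup>2 \<le> h / 2 * (cc * (norm R)\<^sup>2)"
      unfolding mult.assoc [symmetric] by (intro mult_right_mono) (auto simp: a_def)
    also have "\<dots> \<le> h / 2 * W_curv \<mu> Lc b1 b2 b3 R"
      using cc(2) \<open>h > 0\<close> by (intro mult_left_mono) auto
    finally have R: "a * (norm R)\<^sup>2 \<le> h / 2 * W_curv \<mu> Lc b1 b2 b3 R" .
    show ?thesis
      unfolding shell_energy_def distrib_left
      using E R mb [of E "B_tensor y0 x" "C_tensor y0 x" R] bc
      by linarith
  qed
  show ?thesis
    using \<open>a > 0\<close> main by (intro exI [of _ a] conjI allI impI AE_I2) auto
qed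

end
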